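(* Let $\mathcal{G}=(V,\mathcal{I},\mathcal{E},\partial)$ be a finite connected non-compact graph without tadpoles, let $\mathcal{M}=\{M(v)\}_{v\in V}$ be an arbitrary collection of complex $\deg(v)\times\deg(v)$ matrices, and let $\underline{a}=\{a_i\}_{i\in\mathcal{I}}$, $\underline{b}=\{b_i\}_{i\in\mathcal{I}}$ be two arbitrary penalty vectors (vectors with strictly positive components). For $\beta\in\mathbb{C}$ define $$\widehat{T}(\beta)=\begin{pmatrix}\mathbb{I}&0&0\end{pmatrix}\left[\mathbb{I}+\mathbf{M}\,G\,\widehat{H}\right]^{-1}\mathbf{M}\begin{pmatrix}\mathbb{I}\\0\\0\end{pmatrix},\qquad G=\begin{pmatrix}0&0&0\\0&0&\mathbb{I}\\0&\mathbb{I}&0\end{pmatrix},\qquad \widehat{H}=\begin{pmatrix}\mathbb{I}&0&0\\0&e^{-\beta\underline{a}}&0\\0&0&e^{-\beta\underline{b}}\end{pmatrix},$$ with blocks relative to $\mathcal{K}=\mathcal{K}_{\mathcal{E}}\oplus\mathcal{K}_{\mathcal{I}}^{(-)}\oplus\mathcal{K}_{\mathcal{I}}^{(+)}$. For a nontrivial walk $\mathbf{w}=\{e',i_1,\dots,i_N,e\}$ and $p\in\{1,\dots,N\}$ set $c_{i_p}=a_{i_p}$ if the walk traverses the edge $i_p$ in the direction from the terminal to the initial vertex, and $c_{i_p}=b_{i_p}$ if the walk traverses the edge $i_p$ in the direction from the initial to the terminal vertex. Then for all $\beta\in\mathbb{C}$ with $\mathrm{Re}\,\beta$ sufficiently large the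 function $\widehat{T}(\beta)$ equals the generating function of walks with $a_{i_p}$ replaced by $c_{i_p}$, that is, for all $e,e'\in\mathcal{E}$, $$\widehat{T}_{e,e'}(\beta)=\sum_{\mathbf{w}\in\mathcal{W}_{e,e'}}W(\mathbf{w})\,\exp\Big\{-\beta\sum_{p=1}^{|\mathbf{w}|_{\mathrm{comb}}}c_{i_p}\Big\}$$ (for a trivial walk the exponent is $0$).
   Context: **Graph.** $V$ is a finite set of vertices, $\mathcal{I}$ a finite set of internal lines, $\mathcal{E}$ a finite nonempty set of external lines. $\partial$ assigns to each $i\in\mathcal{I}$ an ordered pair $(\partial^-(i),\partial^+(i))$ of vertices (initial and terminal vertex), and to each $e\in\mathcal{E}$ a single vertex $\partial(e)$. No tadpoles: $\partial^-(i)\neq\partial^+(i)$. Multiple lines between two vertices, and several external lines at one vertex, are allowed. A vertex $v$ and a line $j$ are incident if $v\in\partial(j)$; $\mathcal{S}(v)\subset\mathcal{E}\cup\mathcal{I}$ is the set of lines incident with $v$ and $\deg(v)=|\mathcal{S}(v)|$. The matrix $M(v)$ has entries $[M(v)]_{j_1,j_2}$ indexed by $j_1,j_2\in\mathcal{S}(v)$. **Walks.** A nontrivial walk from $e'\in\mathcal{E}$ to $e\in\mathcal{E}$ is a sequence $\mathbf{w}=\{e',i_1,\dots,i_N,e\}$, $N\ge1$, $i_p\in\mathcal{I}$, for which there are vertices $v_0,\dots,v_N$ with $v_0=\partial(e')\in\partial(i_1)$, $v_N=\partial(e)\in\partial(i_N)$, $v_p\in\partial(i_p)\cap\partial(i_{p+1})$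 for $1\le p\le N-1$, and $v_p\ne v_{p+1}$ for $0\le p\le N-1$ (these vertices are unique). At its $p$-th step the walk traverses $i_p$ from $v_{p-1}$ to $v_p$. $|\mathbf{w}|_{\mathrm{comb}}=N$. A trivial walk is $\{e',e\}$ with $\partial(e)=\partial(e')$, with $|\mathbf{w}|_{\mathrm{comb}}=0$. $\mathcal{W}_{e,e'}$ is the set of all walks from $e'$ to $e$. The weight is $W(\mathbf{w})=[M(v_N)]_{e,i_N}\prod_{p=1}^{N-1}[M(v_p)]_{i_{p+1},i_p}\,[M(v_0)]_{i_1,e'}$ for a nontrivial walk and $W(\mathbf{w})=[M(\partial(e))]_{e,e'}$ for a trivial one. The generating function with a single penalty vector $\underline{a}$ is $\sum_{\mathbf{w}\in\mathcal{W}_{e,e'}}W(\mathbf{w})\exp\{-\beta\sum_{p}a_{i_p}\}$. **Matrices.** $\mathcal{K}_{\mathcal{E}}\cong\mathbb{C}^{|\mathcal{E}|}$, $\mathcal{K}_{\mathcal{I}}^{(\pm)}\cong\mathbb{C}^{|\mathcal{I}|}$. Each canonical basis vector $h$ of $\mathcal{K}$ corresponds to an edge $j(h)$ and a vertex $v(h)$: $v(h)=\partial(j(h))$ if $h\in\mathcal{K}_{\mathcal{E}}$, $v(h)=\partial^-(j(h))$ if $h\in\mathcal{K}_{\mathcal{I}}^{(-)}$, $v(h)=\partial^+(j(h))$ if $h\in\mathcal{K}_{\mathcal{I}}^{(+)}$. The linear map $\mathbf{M}$ on $\mathcal{K}$ is given by $\langle h_1,\mathbf{M}h_2\rangle=[M(v(h_1))]_{j(h_1),j(h_2)}$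 if $v(h_1)=v(h_2)$, and $0$ otherwise. $e^{-\beta\underline{a}}$, $e^{-\beta\underline{b}}$ are diagonal $|\mathcal{I}|\times|\mathcal{I}|$ matrices with entries $e^{-\beta a_i}$, $e^{-\beta b_i}$.
   Formalization: The bracket I + M G Ĥ in the definition of T̂(β) is replaced by I − M Ĥ G: the printed sign gives each walk a factor (−1)^N and the printed order exchanges a and b, so the claim fails already for a graph with one internal line. *)

theory Defs
  imports "HOL-Analysis.Analysis" "Graph_Theory.Graph_Theory"
begin

text \<open>
  The interior of the graph is a multi-digraph \<open>G\<close>: \<open>verts G\<close> is $V$, \<open>arcs G\<close> is the set of
  internal lines, \<open>tail G i\<close> the initial vertex $\partial^-(i)$ and \<open>head G i\<close> the terminal
  vertex $\partial^+(i)$.  The external lines are a set \<open>E\<close>, and \<open>bd e\<close> is $\partial(e)$.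
  Connectedness is that of the underlying undirected graph; attaching external lines does not
  affect it.
\<close>

locale noncompact_graph = fin_digraph G + loopfree_digraph G
  for G :: "('v, 'i) pre_digraph" (structure) +
  fixes E :: "'e set" and bd :: "'e \<Rightarrow> 'v"
  assumes connected_interior: "Digraph_Component.connected G"
    and finite_ext: "finite E"
    and ext_nonempty: "E \<noteq> {}"
    and bd_in_verts: "e \<in> E \<Longrightarrow> bd e \<in> verts G"

text \<open>
  A line is an element of \<^typ>\<open>'e + 'i\<close>.  A collection of matrices $M(v)$, with rows and columns
  indexed by the lines incident with $v$, is a function \<open>M\<close> with \<open>M v j\<^sub>1 j\<^sub>2\<close> $= [M(v)]_{j_1,j_2}$;
  values at lines not incident with \<open>v\<close> are never used below.
\<close>

type_synonym ('v, 'i, 'e) vertex_matrices = "'v \<Rightarrow> 'e + 'i \<Rightarrow> 'e + 'i \<Rightarrow> complex"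


section \<open>Walks\<close>

definition ends :: "('v, 'i) pre_digraph \<Rightarrow> 'i \<Rightarrow> 'v set" where
  "ends G i = {tail G i, head G i}"

text \<open>
  A walk from \<open>e'\<close> to \<open>e\<close> is represented by the list \<open>is\<close> of the internal lines between them; the
  empty list is the trivial walk.  As lists count from 0, \<open>is ! p\<close> is $i_{p+1}$, and
  it is traversed from \<open>vs ! p\<close> $= v_p$ to \<open>vs ! Suc p\<close> $= v_{p+1}$.
\<close>

definition walk_vertices ::
  "('v, 'i) pre_digraph \<Rightarrow> ('e \<Rightarrow> 'v) \<Rightarrow> 'e \<Rightarrow> 'i list \<Rightarrow> 'e \<Rightarrow> 'v list \<Rightarrow> bool" where
  "walk_vertices G bd e' is e vs \<longleftrightarrow>
     length vs = Suc (length is) \<and> vs ! 0 = bd e' \<and> vs ! length is = bd e \<and>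
     (\<forall>p < length is. vs ! p \<in> ends G (is ! p) \<and> vs ! Suc p \<in> ends G (is ! p) \<and>
                      vs ! p \<noteq> vs ! Suc p)"

definition walks ::
  "('v, 'i) pre_digraph \<Rightarrow> ('e \<Rightarrow> 'v) \<Rightarrow> 'e \<Rightarrow> 'e \<Rightarrow> 'i list set" where
  "walks G bd e e' = {is. set is \<subseteq> arcs G \<and> (\<exists>vs. walk_vertices G bd e' is e vs)}"

lemma walk_vertices_unique:
  assumes "walk_vertices G bd e' is e vs" and "walk_vertices G bd e' is e ws"
  shows "vs = ws"
proof (rule nth_equalityI)
  show "length vs = length ws"
    using assms by (simp add: walk_vertices_def)
next
  have "p \<le> length is \<Longrightarrow> vs ! p = ws ! p" for p
  proof (induction p)
    case 0
    then show ?case using assms by (simp add: walk_vertices_def)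
  next
    case (Suc p)
    then have p: "p < length is" and eq: "vs ! p = ws ! p" by auto
    from assms p show ?case
      unfolding walk_vertices_def ends_def using eq by (metis insertE singletonD)
  qed
  then show "vs ! p = ws ! p" if "p < length vs" for p
    using that assms(1) by (simp add: walk_vertices_def)
qed

definition wverts ::
  "('v, 'i) pre_digraph \<Rightarrow> ('e \<Rightarrow> 'v) \<Rightarrow> 'e \<Rightarrow> 'i list \<Rightarrow> 'e \<Rightarrow> 'v list" where
  "wverts G bd e' is e = (THE vs. walk_vertices G bd e' is e vs)"

definition walk_weight ::
  "('v, 'i) pre_digraph \<Rightarrow> ('e \<Rightarrow> 'v) \<Rightarrow> ('v, 'i, 'e) vertex_matrices \<Rightarrow>
   'e \<Rightarrow> 'i list \<Rightarrow> 'e \<Rightarrow> complex" where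
  "walk_weight G bd M e' is e =
     (if is = [] then M (bd e) (Inl e) (Inl e')
      else let vs = wverts G bd e' is e; N = length is in
        M (vs ! N) (Inl e) (Inr (is ! (N - 1))) *
        (\<Prod>p = 1..N - 1. M (vs ! p) (Inr (is ! p)) (Inr (is ! (p - 1)))) *
        M (vs ! 0) (Inr (is ! 0)) (Inl e'))"

text \<open>
  The penalty $\sum_p c_{i_p}$: a line contributes its \<open>a\<close>-penalty when it is traversed from its
  terminal to its initial vertex, and its \<open>b\<close>-penalty in the opposite direction.
\<close>

definition walk_penalty ::
  "('v, 'i) pre_digraph \<Rightarrow> ('e \<Rightarrow> 'v) \<Rightarrow> ('i \<Rightarrow> real) \<Rightarrow> ('i \<Rightarrow> real) \<Rightarrow>
   'e \<Rightarrow> 'i list \<Rightarrow> 'e \<Rightarrow> real" where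
  "walk_penalty G bd a b e' is e =
     (let vs = wverts G bd e' is e in
        \<Sum>p < length is.
          if vs ! p = head G (is ! p) \<and> vs ! Suc p = tail G (is ! p)
          then a (is ! p) else b (is ! p))"


section \<open>Matrices on the space spanned by the external and the doubled internal lines\<close>

datatype ('e, 'i) basis_label = Ext 'e | Init 'i | Term 'i

text \<open>
  \<open>Init i\<close> and \<open>Term i\<close> are the copies of \<open>i\<close> in $\mathcal{K}_{\mathcal{I}}^{(-)}$ and
  $\mathcal{K}_{\mathcal{I}}^{(+)}$.  The canonical basis of $\mathcal{K}$ is indexed by an arbitrary
  finite type \<^typ>\<open>'k\<close> that a bijection \<open>lbl\<close> onto \<open>basis_labels G E\<close> identifies with the set of
  these labels, so that $\mathcal{K}$ is \<^typ>\<open>complex^'k\<close> and has dimension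
  $|\mathcal{E}| + 2|\mathcal{I}|$ (where $\mathcal{I}$ may be empty).
\<close>

definition basis_labels :: "('v, 'i) pre_digraph \<Rightarrow> 'e set \<Rightarrow> ('e, 'i) basis_label set" where
  "basis_labels G E = Ext ` E \<union> Init ` arcs G \<union> Term ` arcs G"

fun label_line :: "('e, 'i) basis_label \<Rightarrow> 'e + 'i" where
  "label_line (Ext e) = Inl e"
| "label_line (Init i) = Inr i"
| "label_line (Term i) = Inr i"

fun label_vertex ::
  "('v, 'i) pre_digraph \<Rightarrow> ('e \<Rightarrow> 'v) \<Rightarrow> ('e, 'i) basis_label \<Rightarrow> 'v" where
  "label_vertex G bd (Ext e) = bd e"
| "label_vertex G bd (Init i) = tail G i"
| "label_vertex G bd (Term i) = head G i"

definition big_M ::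
  "('v, 'i) pre_digraph \<Rightarrow> ('e \<Rightarrow> 'v) \<Rightarrow> ('v, 'i, 'e) vertex_matrices \<Rightarrow>
   ('k::finite \<Rightarrow> ('e, 'i) basis_label) \<Rightarrow> complex^'k^'k" where
  "big_M G bd M lbl = (\<chi> h1 h2.
     if label_vertex G bd (lbl h1) = label_vertex G bd (lbl h2)
     then M (label_vertex G bd (lbl h1)) (label_line (lbl h1)) (label_line (lbl h2))
     else 0)"

fun swap_entry :: "('e, 'i) basis_label \<Rightarrow> ('e, 'i) basis_label \<Rightarrow> complex" where
  "swap_entry (Init i) (Term i') = (if i = i' then 1 else 0)"
| "swap_entry (Term i) (Init i') = (if i = i' then 1 else 0)"
| "swap_entry _ _ = 0"

definition G_mat :: "('k::finite \<Rightarrow> ('e, 'i) basis_label) \<Rightarrow> complex^'k^'k" where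
  "G_mat lbl = (\<chi> h1 h2. swap_entry (lbl h1) (lbl h2))"

fun penalty_factor ::
  "('i \<Rightarrow> real) \<Rightarrow> ('i \<Rightarrow> real) \<Rightarrow> complex \<Rightarrow> ('e, 'i) basis_label \<Rightarrow> complex" where
  "penalty_factor a b \<beta> (Ext e) = 1"
| "penalty_factor a b \<beta> (Init i) = exp (- \<beta> * of_real (a i))"
| "penalty_factor a b \<beta> (Term i) = exp (- \<beta> * of_real (b i))"

definition H_mat ::
  "('i \<Rightarrow> real) \<Rightarrow> ('i \<Rightarrow> real) \<Rightarrow> complex \<Rightarrow>
   ('k::finite \<Rightarrow> ('e, 'i) basis_label) \<Rightarrow> complex^'k^'k" where
  "H_mat a b \<beta> lbl = (\<chi> h1 h2. if h1 = h2 then penalty_factor a b \<beta> (lbl h1) else 0)"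

text \<open>
  The matrix $\mathbb{I} - \mathbf{M}\widehat{H}G$ whose inverse enters $\widehat{T}$.  In the
  source $\widehat{T}$ is printed with $\mathbb{I} + \mathbf{M}G\widehat{H}$ instead, but the sign and
  the order of the factors are forced by the generating function.  The Neumann series of
  $[\mathbb{I} - X]^{-1}\mathbf{M}$ is $\sum_n X^n\mathbf{M}$, whereas $\mathbb{I} + X$ in place of
  $\mathbb{I} - X$ would give every walk an extra factor $(-1)^N$.  Next,
  $\mathbf{M}\widehat{H}G\mathbf{M}$ is read from right to left: a walk that reaches \<open>Term i\<close> is moved
  to \<open>Init i\<close> by $G$, that is, it traverses \<open>i\<close> from the terminal to the initial vertex, and then
  takes the factor $e^{-\beta a_i}$ of \<open>Init i\<close>.  With $G\widehat{H}$ in place of $\widehat{H}G$ it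
  would take the factor $e^{-\beta b_i}$ of \<open>Term i\<close>, and \<open>a\<close> and \<open>b\<close> would exchange their roles.
\<close>

definition resolvent_arg ::
  "('v, 'i) pre_digraph \<Rightarrow> ('e \<Rightarrow> 'v) \<Rightarrow> ('v, 'i, 'e) vertex_matrices \<Rightarrow>
   ('i \<Rightarrow> real) \<Rightarrow> ('i \<Rightarrow> real) \<Rightarrow> complex \<Rightarrow>
   ('k::finite \<Rightarrow> ('e, 'i) basis_label) \<Rightarrow> complex^'k^'k" where
  "resolvent_arg G bd M a b \<beta> lbl = mat 1 - big_M G bd M lbl ** H_mat a b \<beta> lbl ** G_mat lbl"

text \<open>
  Multiplication by \<open>(\<one> 0 0)\<close> from the left and by its transpose from the right selects the
  block of external rows and columns.
\<close>

definition T_hat ::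
  "('v, 'i) pre_digraph \<Rightarrow> ('e \<Rightarrow> 'v) \<Rightarrow> ('v, 'i, 'e) vertex_matrices \<Rightarrow>
   ('i \<Rightarrow> real) \<Rightarrow> ('i \<Rightarrow> real) \<Rightarrow> complex \<Rightarrow>
   ('k::finite \<Rightarrow> ('e, 'i) basis_label) \<Rightarrow> 'e \<Rightarrow> 'e \<Rightarrow> complex" where
  "T_hat G bd M a b \<beta> lbl e e' =
     (matrix_inv (resolvent_arg G bd M a b \<beta> lbl) ** big_M G bd M lbl)
       $ inv lbl (Ext e) $ inv lbl (Ext e')"

end

theory Submission
  imports Defs "HOL-Real_Asymp.Real_Asymp"
begin

text \<open>
  Each step of a walk is recorded by the copy of the traversed line at the vertex where the step
  ends.  A walk then becomes a list of basis vectors, its weight a product of entries of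
  $Y = \widehat{H}G\mathbf{M}$, and lists that do not come from walks have weight 0.  Once the column
  sums of $|Y|$ are at most $1/2$, which holds for large $\mathrm{Re}\,\beta$, the weights of all lists
  are absolutely summable; splitting off the first entry of a list shows that
  the sums solve the linear system with matrix $\mathbb{I} - Y$.  The push-through identity
  $[\mathbb{I} - \mathbf{M}\widehat{H}G]^{-1}\mathbf{M} = \mathbf{M}[\mathbb{I} - Y]^{-1}$
  identifies the solution as $\widehat{T}$.
\<close>

section \<open>Sums of path weights over all lists\<close>

text \<open>\<open>(h # fs) ! p\<close> is the predecessor of \<open>fs ! p\<close>, so each factor
  leaves a column of \<open>Y\<close> and enters a row. The index \<open>length fs\<close> picks the
  last vector reached, which is \<open>h\<close> for the empty list; \<open>R\<close> weights the
  end of the path.\<close>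

definition path_weight :: "complex^'k \<Rightarrow> complex^'k^'k \<Rightarrow> 'k \<Rightarrow> 'k list \<Rightarrow> complex" where
  "path_weight R Y h fs = R $ ((h # fs) ! length fs) * (\<Prod>p<length fs. Y $ (fs ! p) $ ((h # fs) ! p))"

lemma path_weight_Nil [simp]: "path_weight R Y h [] = R $ h"
  by (simp add: path_weight_def)

lemma path_weight_Cons [simp]: "path_weight R Y h (f # fs) = Y $ f $ h * path_weight R Y f fs"
  by (simp add: path_weight_def prod.lessThan_Suc_shift del: prod.lessThan_Suc)

text \<open>Splitting off the first vector turns a bound s for length \<open>n\<close> into C + s /
  2 for length \<open>Suc n\<close>, and 2 * C is the fixed point of this map. The start
  \<open>h\<close> varies in the induction because the remaining path starts at the vector split
  off.\<close>

lemma sum_norm_path_weight_le: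
  fixes R :: "complex^'k::finite"
  assumes Y: "\<And>h. (\<Sum>f\<in>UNIV. norm (Y $ f $ h)) \<le> 1 / 2"
    and R: "\<And>h. norm (R $ h) \<le> C"
  shows "(\<Sum>fs | length fs \<le> n. norm (path_weight R Y h fs)) \<le> 2 * C"
proof (induction n arbitrary: h)
  have C: "0 \<le> C"
    using R[of h] norm_ge_zero order_trans by blast
  {
    case 0
    show ?case using R[of h] C by simp
  next
    case (Suc n)
    define L where "L = {fs :: 'k list. length fs \<le> n}"
    have fin: "finite L"
      unfolding L_def using finite_lists_length_le[of "UNIV :: 'k set" n] by simp
    have split: "{fs :: 'k list. length fs \<le> Suc n} = insert [] ((\<lambda>(f, fs). f # fs) ` (UNIV \<times> L))"
      unfolding L_def by (auto simp: image_iff) (metis Suc_le_mono list.exhaust length_Cons)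
    have inj: "inj_on (\<lambda>(f, fs). f # fs) (UNIV \<times> L)"
      by (auto simp: inj_on_def)
    have "(\<Sum>fs | length fs \<le> Suc n. norm (path_weight R Y h fs))
        = norm (R $ h) + (\<Sum>(f, fs)\<in>UNIV \<times> L. norm (path_weight R Y h (f # fs)))"
      unfolding split using fin
      by (subst sum.insert) (auto simp: sum.reindex[OF inj] o_def simp del: path_weight_Cons intro!: sum.cong)
    also have "(\<Sum>(f, fs)\<in>UNIV \<times> L. norm (path_weight R Y h (f # fs)))
        = (\<Sum>f\<in>UNIV. norm (Y $ f $ h) * (\<Sum>fs\<in>L. norm (path_weight R Y f fs)))"
      by (simp add: sum.cartesian_product[symmetric] norm_mult sum_distrib_left)
    also have "\<dots> \<le> (\<Sum>f\<in>UNIV. norm (Y $ f $ h) * (2 * C))"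
      using Suc.IH unfolding L_def by (intro sum_mono mult_left_mono) auto
    also have "\<dots> = (\<Sum>f\<in>UNIV. norm (Y $ f $ h)) * (2 * C)"
      by (simp add: sum_distrib_right)
    also have "\<dots> \<le> 1 / 2 * (2 * C)"
      using Y C by (intro mult_right_mono) auto
    finally show ?case using R[of h] by linarith
  }
qed

text \<open>A finite set of lists has bounded length, so a bound that is uniform in the length
  controls all finite partial sums of norms.\<close>

lemma path_weight_summable:
  fixes R :: "complex^'k::finite"
  assumes Y: "\<And>h. (\<Sum>f\<in>UNIV. norm (Y $ f $ h)) \<le> 1 / 2"
  shows "path_weight R Y h summable_on UNIV"
proof (rule abs_summable_summable, rule nonneg_bdd_above_summable_on)
  show "bdd_above (sum (\<lambda>fs. norm (path_weight R Y h fs)) ` {F. F \<subseteq> UNIV \<and> finite F})"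
  proof (intro bdd_aboveI2)
    fix F :: "'k list set"
    assume "F \<in> {F. F \<subseteq> UNIV \<and> finite F}"
    then have fin: "finite F" by simp
    \<comment> \<open>For empty \<open>F\<close> this is an unspecified number, and the inclusion
      used next holds trivially.\<close>
    define n where "n = Max (length ` F)"
    have "(\<Sum>fs\<in>F. norm (path_weight R Y h fs))
        \<le> (\<Sum>fs | length fs \<le> n. norm (path_weight R Y h fs))"
      using fin finite_lists_length_le[of "UNIV :: 'k set" n]
      by (intro sum_mono2) (auto simp: n_def)
    also have "\<dots> \<le> 2 * norm R"
      by (rule sum_norm_path_weight_le[OF Y Finite_Cartesian_Product.norm_nth_le])
    finally show "(\<Sum>fs\<in>F. norm (path_weight R Y h fs)) \<le> 2 * norm R" .
  qed
qed simp

text \<open>A list is empty or has one of finitely many first vectors, so the sum splits into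
  finitely many disjoint pieces, each a multiple of a full sum with a new start.\<close>

lemma path_weight_sum_step:
  fixes R :: "complex^'k::finite"
  assumes "\<And>h. path_weight R Y h summable_on UNIV"
  shows "(\<Sum>\<^sub>\<infinity>fs. path_weight R Y h fs)
    = R $ h + (\<Sum>f\<in>UNIV. Y $ f $ h * (\<Sum>\<^sub>\<infinity>fs. path_weight R Y f fs))"
proof -
  have tails: "(path_weight R Y h has_sum (Y $ f $ h * (\<Sum>\<^sub>\<infinity>fs. path_weight R Y f fs))) (range (Cons f))"
    for f
  proof -
    have "((\<lambda>fs. Y $ f $ h * path_weight R Y f fs) has_sum
        (Y $ f $ h * (\<Sum>\<^sub>\<infinity>fs. path_weight R Y f fs))) UNIV"
      by (intro has_sum_cmult_right has_sum_infsum assms)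
    then show ?thesis
      by (subst has_sum_reindex) (auto simp: o_def)
  qed
  have "(path_weight R Y h has_sum (\<Sum>f\<in>UNIV. Y $ f $ h * (\<Sum>\<^sub>\<infinity>fs. path_weight R Y f fs)))
      (\<Union>f. range (Cons f))"
    by (intro sum_has_sum tails) auto
  moreover have "(path_weight R Y h has_sum (R $ h)) {[]}"
    using has_sum_finite[of "{[]}" "path_weight R Y h"] by simp
  ultimately have "(path_weight R Y h has_sum
      (R $ h + (\<Sum>f\<in>UNIV. Y $ f $ h * (\<Sum>\<^sub>\<infinity>fs. path_weight R Y f fs)))) ({[]} \<union> (\<Union>f. range (Cons f)))"
    by (intro has_sum_Un_disjoint) auto
  moreover have "{[]} \<union> (\<Union>f. range (Cons f)) = UNIV"
    by (auto simp: image_iff) (metis list.exhaust)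
  ultimately have "(path_weight R Y h has_sum
      (R $ h + (\<Sum>f\<in>UNIV. Y $ f $ h * (\<Sum>\<^sub>\<infinity>fs. path_weight R Y f fs)))) UNIV"
    by (rule subst[rotated])
  then show ?thesis
    by (rule infsumI)
qed

section \<open>The linear system solved by the sums\<close>

text \<open>If \<open>x = x v* Y\<close>, the column sums bound the largest modulus m of an entry of
  \<open>x\<close> by m / 2, so \<open>x\<close> vanishes.\<close>

lemma invertible_one_minus:
  fixes Y :: "complex^'k::finite^'k"
  assumes Y: "\<And>h. (\<Sum>f\<in>UNIV. norm (Y $ f $ h)) \<le> 1 / 2"
  shows "invertible (mat 1 - Y)"
proof -
  have "x = 0" if x: "x v* (mat 1 - Y) = 0" for x
  proof -
    define m where "m = Max (range (\<lambda>h. norm (x $ h)))"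
    have le: "norm (x $ h) \<le> m" for h
      unfolding m_def by (intro Max_ge) auto
    have "m \<in> range (\<lambda>h. norm (x $ h))"
      unfolding m_def by (intro Max_in) auto
    then obtain h where h: "m = norm (x $ h)" by auto
    have "x = x v* Y"
      using x by (simp add: vector_matrix_mult_diff_rdistrib)
    then have "x $ h = (\<Sum>f\<in>UNIV. Y $ f $ h * x $ f)"
      by (metis (no_types, lifting) mult.commute sum.cong vec_lambda_beta vector_matrix_mult_def)
    then have "m \<le> (\<Sum>f\<in>UNIV. norm (Y $ f $ h * x $ f))"
      unfolding h by (metis norm_sum)
    also have "\<dots> \<le> (\<Sum>f\<in>UNIV. norm (Y $ f $ h) * m)"
      unfolding norm_mult by (intro sum_mono mult_left_mono le) auto
    also have "\<dots> = (\<Sum>f\<in>UNIV. norm (Y $ f $ h)) * m"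
      by (simp add: sum_distrib_right)
    also have "\<dots> \<le> 1 / 2 * m"
      using Y by (intro mult_right_mono) (auto simp: h)
    finally have "m \<le> 0" by linarith
    then have "norm (x $ h') \<le> 0" for h'
      using le order_trans by blast
    then show "x = 0" by (simp add: vec_eq_iff)
  qed
  \<comment> \<open>The kernel criterion concerns column vectors, hence the transpose. Transposing
    back yields a right inverse, which suffices for a square matrix.\<close>
  then have "\<exists>B. B ** transpose (mat 1 - Y) = mat 1"
    by (simp add: matrix_left_invertible_ker)
  then show ?thesis
    unfolding invertible_right_inverse by (metis matrix_transpose_mul transpose_mat transpose_transpose)
qed

lemma
  assumes "invertible A"
  shows matrix_inv_right: "A ** matrix_inv A = mat 1"
    and matrix_inv_left: "matrix_inv A ** A = mat 1"
  using someI_ex[OF assms[unfolded invertible_def]] unfolding matrix_inv_def by blast+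

text \<open>The vector \<open>S\<close> of all sums satisfies \<open>S = R + S v* Y\<close>; solving
  this equation gives the closed form without expanding powers of \<open>Y\<close>.\<close>

lemma path_weight_has_sum:
  fixes R :: "complex^'k::finite"
  assumes Y: "\<And>h. (\<Sum>f\<in>UNIV. norm (Y $ f $ h)) \<le> 1 / 2"
  shows "(path_weight R Y h has_sum (R v* matrix_inv (mat 1 - Y)) $ h) UNIV"
proof -
  define S where "S = (\<chi> h. \<Sum>\<^sub>\<infinity>fs. path_weight R Y h fs)"
  have summable: "path_weight R Y h summable_on UNIV" for h
    by (rule path_weight_summable[OF Y])
  have "S $ h = R $ h + (\<Sum>f\<in>UNIV. Y $ f $ h * S $ f)" for h
    unfolding S_def vec_lambda_beta by (rule path_weight_sum_step[OF summable])
  moreover have "(R + S v* Y) $ h = R $ h + (\<Sum>f\<in>UNIV. Y $ f $ h * S $ f)" for h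
    by (simp add: vector_matrix_mult_def mult.commute)
  ultimately have "S = R + S v* Y"
    by (metis vec_eq_iff)
  then have "S v* (mat 1 - Y) = R"
    by (simp add: vector_matrix_mult_diff_rdistrib diff_eq_eq)
  then have "R v* matrix_inv (mat 1 - Y) = S v* ((mat 1 - Y) ** matrix_inv (mat 1 - Y))"
    by (metis vector_matrix_mul_assoc)
  also have "\<dots> = S"
    using invertible_one_minus[OF Y] by (simp add: matrix_inv_right)
  finally show ?thesis
    using has_sum_infsum[OF summable] by (simp add: S_def)
qed

section \<open>The push-through identity\<close>

lemma matrix_diff_ldistrib:
  fixes A :: "'a::ring_1^'n^'m"
  shows "A ** (B - C) = A ** B - A ** C"
  by (simp add: vec_eq_iff matrix_matrix_mult_def sum_subtractf right_diff_distrib)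

lemma matrix_diff_rdistrib:
  fixes A :: "'a::ring_1^'n^'m"
  shows "(A - B) ** C = A ** C - B ** C"
  by (simp add: vec_eq_iff matrix_matrix_mult_def sum_subtractf left_diff_distrib)

text \<open>Both M (1 - Z M) and (1 - M Z) M equal M - M Z M; multiplying by the two inverses moves
  \<open>M\<close> across.\<close>

lemma push_through:
  fixes M Z :: "complex^'k::finite^'k"
  assumes "invertible (mat 1 - Z ** M)"
  shows "invertible (mat 1 - M ** Z)"
    and "matrix_inv (mat 1 - M ** Z) ** M = M ** matrix_inv (mat 1 - Z ** M)"
proof -
  define U where "U = matrix_inv (mat 1 - Z ** M)"
  have U: "(mat 1 - Z ** M) ** U = mat 1"
    unfolding U_def using assms by (simp add: matrix_inv_right)
  have comm: "(mat 1 - M ** Z) ** M = M ** (mat 1 - Z ** M)"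
    by (simp add: matrix_diff_ldistrib matrix_diff_rdistrib matrix_mul_assoc)
  have MU: "(mat 1 - M ** Z) ** (M ** U) = M"
    by (metis comm U matrix_mul_assoc matrix_mul_rid)
  \<comment> \<open>The right inverse 1 + M U Z is found by formally summing (M Z)^n = M (Z M)^(n-1)
    Z over n \<ge> 1.\<close>
  have "(mat 1 - M ** Z) ** (mat 1 + M ** U ** Z) = mat 1 - M ** Z + (mat 1 - M ** Z) ** (M ** U) ** Z"
    by (simp add: matrix_add_ldistrib matrix_mul_assoc)
  also have "\<dots> = mat 1"
    by (simp add: MU)
  finally show inv: "invertible (mat 1 - M ** Z)"
    using invertible_right_inverse by blast
  show "matrix_inv (mat 1 - M ** Z) ** M = M ** matrix_inv (mat 1 - Z ** M)"
    unfolding U_def[symmetric]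
    by (metis MU inv matrix_inv_left matrix_mul_assoc matrix_mul_lid)
qed

section \<open>Matrix entries in terms of labels\<close>

text \<open>The value at \<open>Ext e\<close> is a default that keeps \<open>opposite\<close> inside
  \<open>basis_labels G E\<close>.\<close>

fun opposite :: "('e, 'i) basis_label \<Rightarrow> ('e, 'i) basis_label" where
  "opposite (Ext e) = Ext e"
| "opposite (Init i) = Term i"
| "opposite (Term i) = Init i"

fun is_internal :: "('e, 'i) basis_label \<Rightarrow> bool" where
  "is_internal (Ext e) = False"
| "is_internal (Init i) = True"
| "is_internal (Term i) = True"

text \<open>Stated for labels instead of indices, so that it applies to
  \<open>opposite (lbl f)\<close> without inverting \<open>lbl\<close>.\<close>

definition vertex_entry ::
  "('v, 'i) pre_digraph \<Rightarrow> ('e \<Rightarrow> 'v) \<Rightarrow> ('v, 'i, 'e) vertex_matrices \<Rightarrow>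
   ('e, 'i) basis_label \<Rightarrow> ('e, 'i) basis_label \<Rightarrow> complex" where
  "vertex_entry G bd M l l' =
     (if label_vertex G bd l = label_vertex G bd l'
      then M (label_vertex G bd l) (label_line l) (label_line l') else 0)"

lemma big_M_nth: "big_M G bd M lbl $ h $ h' = vertex_entry G bd M (lbl h) (lbl h')"
  by (simp add: big_M_def vertex_entry_def)

text \<open>With at most one nonzero entry in each row, multiplication by \<open>G_mat\<close>
  collapses to a single term.\<close>

lemma swap_entry_eq: "swap_entry l l' = (if is_internal l \<and> l' = opposite l then 1 else 0)"
  by (cases l; cases l') auto

text \<open>Prepending \<open>Inl e'\<close> makes the first step and the trivial walk follow the
  general pattern, which is that of \<open>path_weight\<close>. For the trivial walk the second
  hypothesis identifies \<open>vs ! 0\<close> with the vertex \<open>bd e\<close> of its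
  weight.\<close>

lemma walk_weight_eq:
  assumes "wverts G bd e' is e = vs" and "vs ! length is = bd e"
  shows "walk_weight G bd M e' is e
    = M (vs ! length is) (Inl e) ((Inl e' # map Inr is) ! length is) *
      (\<Prod>p<length is. M (vs ! p) (Inr (is ! p)) ((Inl e' # map Inr is) ! p))"
proof (cases "length is")
  case 0
  then show ?thesis using assms by (simp add: walk_weight_def)
next
  case (Suc n)
  have "(\<Prod>p<length is. M (vs ! p) (Inr (is ! p)) ((Inl e' # map Inr is) ! p))
      = M (vs ! 0) (Inr (is ! 0)) (Inl e') *
        (\<Prod>p<n. M (vs ! Suc p) (Inr (is ! Suc p)) (map Inr is ! p))"
    unfolding Suc by (simp add: prod.lessThan_Suc_shift del: prod.lessThan_Suc)
  also have "(\<Prod>p<n. M (vs ! Suc p) (Inr (is ! Suc p)) (map Inr is ! p))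
      = (\<Prod>p<n. M (vs ! Suc p) (Inr (is ! Suc p)) (Inr (is ! p)))"
    using Suc by (intro prod.cong) auto
  also have "\<dots> = (\<Prod>p = 1..n. M (vs ! p) (Inr (is ! p)) (Inr (is ! (p - 1))))"
    by (simp add: prod.atLeast1_atMost_eq)
  finally show ?thesis
    using Suc assms(1) by (auto simp: walk_weight_def Let_def)
qed

section \<open>The step matrix and its decay\<close>

locale labelled_graph = noncompact_graph G E bd
  for G :: "('v, 'i) pre_digraph" (structure) and E :: "'e set" and bd :: "'e \<Rightarrow> 'v" +
  fixes M :: "('v, 'i, 'e) vertex_matrices"
    and a b :: "'i \<Rightarrow> real"
    and lbl :: "'k::finite \<Rightarrow> ('e, 'i) basis_label"
  assumes a_pos: "i \<in> arcs G \<Longrightarrow> a i > 0"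
    and b_pos: "i \<in> arcs G \<Longrightarrow> b i > 0"
    and bij_lbl: "bij_betw lbl UNIV (basis_labels G E)"
begin

lemma lbl_mem: "lbl h \<in> basis_labels G E"
  using bij_lbl by (auto simp: bij_betw_def)

lemma inv_lbl [simp]: "inv lbl (lbl h) = h"
  using bij_betw_inv_into_left[OF bij_lbl] by simp

lemma lbl_inv [simp]: "l \<in> basis_labels G E \<Longrightarrow> lbl (inv lbl l) = l"
  using bij_betw_inv_into_right[OF bij_lbl] .

lemma finite_basis_labels: "finite (basis_labels G E)"
  using bij_betw_finite[OF bij_lbl] by simp

lemma opposite_mem: "l \<in> basis_labels G E \<Longrightarrow> opposite l \<in> basis_labels G E"
  by (auto simp: basis_labels_def)

definition step_matrix :: "complex \<Rightarrow> complex^'k^'k" where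
  "step_matrix \<beta> = H_mat a b \<beta> lbl ** G_mat lbl ** big_M G bd M lbl"

text \<open>A walk standing at \<open>h\<close> is scattered at its vertex into the near copy of a
  line, carried by \<open>G_mat\<close> to the far copy \<open>f\<close>, and charged the penalty of
  \<open>f\<close>.\<close>

lemma step_matrix_nth:
  "step_matrix \<beta> $ f $ h =
     (if is_internal (lbl f)
      then penalty_factor a b \<beta> (lbl f) * vertex_entry G bd M (opposite (lbl f)) (lbl h) else 0)"
proof -
  have HG: "(H_mat a b \<beta> lbl ** G_mat lbl) $ f $ g = penalty_factor a b \<beta> (lbl f) * swap_entry (lbl f) (lbl g)"
    for f g
    by (simp add: matrix_matrix_mult_def H_mat_def G_mat_def if_distrib[of "\<lambda>x. x * _"] cong: if_cong)
  have "step_matrix \<beta> $ f $ h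
      = (\<Sum>g\<in>UNIV. penalty_factor a b \<beta> (lbl f) * swap_entry (lbl f) (lbl g) * vertex_entry G bd M (lbl g) (lbl h))"
    unfolding step_matrix_def by (subst matrix_matrix_mult_def) (simp add: HG big_M_nth)
  \<comment> \<open>Summing over labels instead of indices lets the only surviving term be named
    \<open>opposite (lbl f)\<close>.\<close>
  also have "\<dots> = (\<Sum>l\<in>basis_labels G E.
      penalty_factor a b \<beta> (lbl f) * swap_entry (lbl f) l * vertex_entry G bd M l (lbl h))"
    by (rule sum.reindex_bij_betw[OF bij_lbl])
  also have "\<dots> = (\<Sum>l\<in>basis_labels G E. if l = opposite (lbl f) then
      (if is_internal (lbl f)
       then penalty_factor a b \<beta> (lbl f) * vertex_entry G bd M (opposite (lbl f)) (lbl h) else 0) else 0)"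
    by (intro sum.cong) (auto simp: swap_entry_eq)
  also have "\<dots> = (if is_internal (lbl f)
      then penalty_factor a b \<beta> (lbl f) * vertex_entry G bd M (opposite (lbl f)) (lbl h) else 0)"
    using finite_basis_labels opposite_mem[OF lbl_mem] by simp
  finally show ?thesis .
qed

text \<open>Positive penalties make each entry decay exponentially, and there are finitely many
  entries, so one \<open>R\<close> serves all columns.\<close>

lemma step_matrix_small:
  "\<exists>R. \<forall>\<beta>. Re \<beta> > R \<longrightarrow> (\<forall>h. (\<Sum>f\<in>UNIV. norm (step_matrix \<beta> $ f $ h)) \<le> 1 / 2)"
proof -
  \<comment> \<open>The modulus of \<open>exp (- \<beta> * c)\<close> with real \<open>c\<close>
    depends only on \<open>Re \<beta>\<close>, which reduces the claim to a limit in one real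
    variable.\<close>
  have norm_cong: "norm (step_matrix \<beta> $ f $ h) = norm (step_matrix (of_real (Re \<beta>)) $ f $ h)" for \<beta> f h
    by (cases "lbl f") (auto simp: step_matrix_nth norm_mult)
  have "((\<lambda>x. norm (step_matrix (of_real x) $ f $ h)) \<longlongrightarrow> 0) at_top" for f h
  proof -
    have decay: "((\<lambda>x. exp (- (x * c)) * K) \<longlongrightarrow> 0) at_top" if "c > 0" for c K :: real
      using that by real_asymp
    show ?thesis
      using lbl_mem[of f] a_pos b_pos
      by (cases "lbl f") (auto simp: step_matrix_nth norm_mult basis_labels_def intro!: decay)
  qed
  then have "((\<lambda>x. \<Sum>f\<in>UNIV. norm (step_matrix (of_real x) $ f $ h)) \<longlongrightarrow> 0) at_top" for h
    by (intro tendsto_null_sum)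
  then have "\<forall>\<^sub>F x in at_top. (\<Sum>f\<in>UNIV. norm (step_matrix (of_real x) $ f $ h)) < 1 / 2" for h
    by (rule order_tendstoD) simp
  then have "\<forall>\<^sub>F x in at_top. \<forall>h. (\<Sum>f\<in>UNIV. norm (step_matrix (of_real x) $ f $ h)) < 1 / 2"
    by (rule eventually_all_finite)
  then obtain R where "\<And>x h. x \<ge> R \<Longrightarrow> (\<Sum>f\<in>UNIV. norm (step_matrix (of_real x) $ f $ h)) < 1 / 2"
    unfolding eventually_at_top_linorder by blast
  then show ?thesis
    by (subst norm_cong) (meson less_imp_le)
qed

section \<open>The bijection between walks and lists of basis vectors\<close>

definition vertex_list :: "'e \<Rightarrow> 'k list \<Rightarrow> 'v list" where
  "vertex_list e' fs = bd e' # map (\<lambda>f. label_vertex G bd (lbl f)) fs"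

definition line_list :: "'k list \<Rightarrow> 'i list" where
  "line_list fs = map (\<lambda>f. projr (label_line (lbl f))) fs"

lemma length_line_list: "length (line_list fs) = length fs"
  by (simp add: line_list_def)

text \<open>These lists encode walks: the near end of each line, given by \<open>opposite\<close>,
  must be the vertex reached before it, and the last vertex must be that of
  \<open>e\<close>.\<close>

definition label_walks :: "'e \<Rightarrow> 'e \<Rightarrow> 'k list set" where
  "label_walks e e' = {fs.
     (\<forall>p<length fs. is_internal (lbl (fs ! p)) \<and>
        label_vertex G bd (opposite (lbl (fs ! p))) = vertex_list e' fs ! p) \<and>
     vertex_list e' fs ! length fs = bd e}"

text \<open>Inverse to \<open>line_list\<close> on walks: the vertex where a step ends decides which
  copy of the line records it.\<close>

definition label_list :: "'e \<Rightarrow> 'e \<Rightarrow> 'i list \<Rightarrow> 'k list" where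
  "label_list e e' is = map (\<lambda>p. inv lbl
     (if wverts G bd e' is e ! Suc p = tail G (is ! p) then Init (is ! p) else Term (is ! p)))
     [0..<length is]"

lemma wverts_eq: "walk_vertices G bd e' is e vs \<Longrightarrow> wverts G bd e' is e = vs"
  unfolding wverts_def by (rule the_equality) (auto intro: walk_vertices_unique)

text \<open>An internal label and its \<open>opposite\<close> sit at the two ends of a line, which
  are distinct in a graph without loops.\<close>

lemma walk_vertices_line_list:
  assumes "fs \<in> label_walks e e'"
  shows "walk_vertices G bd e' (line_list fs) e (vertex_list e' fs)"
proof -
  have "vertex_list e' fs ! p \<in> ends G (line_list fs ! p)
      \<and> vertex_list e' fs ! Suc p \<in> ends G (line_list fs ! p)
      \<and> vertex_list e' fs ! p \<noteq> vertex_list e' fs ! Suc p" if p: "p < length fs" for p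
  proof -
    have "is_internal (lbl (fs ! p))"
      "vertex_list e' fs ! p = label_vertex G bd (opposite (lbl (fs ! p)))"
      using assms p by (auto simp: label_walks_def)
    moreover have "vertex_list e' fs ! Suc p = label_vertex G bd (lbl (fs ! p))"
      using p by (simp add: vertex_list_def)
    ultimately show ?thesis
      using p lbl_mem[of "fs ! p"]
      by (cases "lbl (fs ! p)") (auto simp: no_loops no_loops[symmetric] line_list_def ends_def basis_labels_def)
  qed
  then show ?thesis
    using assms by (simp add: walk_vertices_def line_list_def label_walks_def) (simp add: vertex_list_def)
qed

lemma line_list_in_walks:
  assumes "fs \<in> label_walks e e'"
  shows "line_list fs \<in> walks G bd e e'"
proof -
  have "projr (label_line (lbl f)) \<in> arcs G" if "f \<in> set fs" for f
  proof -
    have "is_internal (lbl f)"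
      using that assms by (auto simp: label_walks_def in_set_conv_nth)
    then show ?thesis
      using lbl_mem[of f] by (cases "lbl f") (auto simp: basis_labels_def)
  qed
  then show ?thesis
    using walk_vertices_line_list[OF assms] by (auto simp: walks_def) (auto simp: line_list_def)
qed

lemma wverts_line_list: "fs \<in> label_walks e e' \<Longrightarrow> wverts G bd e' (line_list fs) e = vertex_list e' fs"
  by (rule wverts_eq[OF walk_vertices_line_list])

text \<open>Since no line is a loop, the vertex where a step ends distinguishes \<open>Init\<close>
  from \<open>Term\<close>.\<close>

lemma label_list_line_list:
  assumes "fs \<in> label_walks e e'"
  shows "label_list e e' (line_list fs) = fs"
proof (rule nth_equalityI)
  show "length (label_list e e' (line_list fs)) = length fs"
    by (simp add: label_list_def line_list_def)
  fix p assume "p < length (label_list e e' (line_list fs))"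
  then have p: "p < length fs"
    by (simp add: label_list_def line_list_def)
  then have "is_internal (lbl (fs ! p))"
    using assms by (auto simp: label_walks_def)
  then have eq: "(if vertex_list e' fs ! Suc p = tail G (line_list fs ! p)
      then Init (line_list fs ! p) else Term (line_list fs ! p)) = lbl (fs ! p)"
    using p lbl_mem[of "fs ! p"]
    by (cases "lbl (fs ! p)")
      (auto simp: no_loops no_loops[symmetric] vertex_list_def line_list_def basis_labels_def)
  have "label_list e e' (line_list fs) ! p
      = inv lbl (if vertex_list e' fs ! Suc p = tail G (line_list fs ! p)
          then Init (line_list fs ! p) else Term (line_list fs ! p))"
    using p by (simp add: label_list_def wverts_line_list[OF assms] length_line_list)
  then show "label_list e e' (line_list fs) ! p = fs ! p"
    unfolding eq by simp
qed

lemma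
  assumes "is \<in> walks G bd e e'"
  shows label_list_in_label_walks: "label_list e e' is \<in> label_walks e e'"
    and line_list_label_list: "line_list (label_list e e' is) = is"
proof -
  obtain vs where vs: "walk_vertices G bd e' is e vs" and arcs: "set is \<subseteq> arcs G"
    using assms by (auto simp: walks_def)
  define N where "N = length is"
  define l :: "nat \<Rightarrow> ('e, 'i) basis_label" where "l p = (if vs ! Suc p = tail G (is ! p) then Init (is ! p) else Term (is ! p))" for p
  have eq: "label_list e e' is = map (\<lambda>p. inv lbl (l p)) [0..<N]"
    by (simp add: label_list_def wverts_eq[OF vs] l_def N_def)
  have l: "lbl (inv lbl (l p)) = l p" if "p < N" for p
  proof -
    have "is ! p \<in> arcs G"
      using that arcs by (auto simp: N_def)
    then show ?thesis
      by (intro lbl_inv) (auto simp: l_def basis_labels_def)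
  qed
  show "line_list (label_list e e' is) = is"
  proof (rule nth_equalityI)
    fix p assume "p < length (line_list (label_list e e' is))"
    then have p: "p < N" by (simp add: length_line_list eq)
    have "projr (label_line (l p)) = is ! p"
      by (simp add: l_def)
    then show "line_list (label_list e e' is) ! p = is ! p"
      using p by (simp add: line_list_def eq l)
  qed (simp add: length_line_list eq N_def)
  \<comment> \<open>Both vertices are ends of the same line and they differ, so the end of arrival
    determines the end of departure.\<close>
  have vs_Suc: "vs ! Suc p = label_vertex G bd (l p)"
    and vs_p: "vs ! p = label_vertex G bd (opposite (l p))" if "p < N" for p
    using vs that by (auto simp: walk_vertices_def ends_def N_def l_def)
  have "vertex_list e' (label_list e e' is) = vs"
  proof (rule nth_equalityI)
    show "length (vertex_list e' (label_list e e' is)) = length vs"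
      using vs by (simp add: vertex_list_def walk_vertices_def eq N_def)
    fix p assume "p < length (vertex_list e' (label_list e e' is))"
    then show "vertex_list e' (label_list e e' is) ! p = vs ! p"
      using vs by (cases p) (auto simp: vertex_list_def eq l vs_Suc walk_vertices_def)
  qed
  moreover have "is_internal (l p)" for p
    by (simp add: l_def)
  moreover have "vs ! N = bd e"
    using vs by (simp add: walk_vertices_def N_def)
  ultimately show "label_list e e' is \<in> label_walks e e'"
    unfolding label_walks_def by (simp add: eq l vs_p[symmetric])
qed

section \<open>Path weights as weights of walks\<close>

text \<open>Prepending the start vector aligns the indices: entry \<open>p\<close> of the extended
  list sits at the vertex from which step \<open>p\<close> departs.\<close>

lemma label_vertex_nth:
  assumes "e' \<in> E" and "p \<le> length fs"
  shows "label_vertex G bd (lbl ((inv lbl (Ext e') # fs) ! p)) = vertex_list e' fs ! p"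
proof (cases p)
  case 0
  have "Ext e' \<in> basis_labels G E"
    using assms(1) by (simp add: basis_labels_def)
  then show ?thesis using 0 by (simp add: vertex_list_def)
next
  case (Suc q)
  then show ?thesis using assms(2) by (simp add: vertex_list_def)
qed

text \<open>Each step contributes a vertex matrix entry and an exponential. The entries multiply to
  the weight of the walk, the exponents add up to its penalty, and the row of \<open>Ext e\<close>
  supplies the last scattering.\<close>

lemma path_weight_label_walk:
  assumes e: "e \<in> E" and e': "e' \<in> E" and fs: "fs \<in> label_walks e e'"
  shows "path_weight (big_M G bd M lbl $ inv lbl (Ext e)) (step_matrix \<beta>) (inv lbl (Ext e')) fs
    = walk_weight G bd M e' (line_list fs) e *
      exp (- \<beta> * of_real (walk_penalty G bd a b e' (line_list fs) e))"
proof -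
  define h where "h = inv lbl (Ext e')"
  define vs where "vs = vertex_list e' fs"
  define ls where "ls = line_list fs"
  define N where "N = length fs"
  have len: "length ls = N" by (simp add: ls_def line_list_def N_def)
  define c where "c p = (if vs ! p = head G (ls ! p) \<and> vs ! Suc p = tail G (ls ! p)
    then a (ls ! p) else b (ls ! p))" for p
  have wv: "wverts G bd e' ls e = vs"
    unfolding vs_def ls_def by (rule wverts_line_list[OF fs])
  have vsN: "vs ! N = bd e"
    using fs by (simp add: label_walks_def vs_def N_def)
  have mem: "Ext e \<in> basis_labels G E" "Ext e' \<in> basis_labels G E"
    using e e' by (auto simp: basis_labels_def)
  have vertex: "label_vertex G bd (lbl ((h # fs) ! p)) = vs ! p" if "p \<le> N" for p
    using label_vertex_nth[OF e'] that by (simp add: h_def vs_def N_def)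
  have line: "label_line (lbl ((h # fs) ! p)) = (Inl e' # map Inr ls) ! p" if "p \<le> N" for p
  proof (cases p)
    case 0
    then show ?thesis using mem by (simp add: h_def)
  next
    case (Suc q)
    then have "is_internal (lbl (fs ! q))"
      using fs that by (auto simp: label_walks_def N_def)
    then show ?thesis
      using Suc that by (cases "lbl (fs ! q)") (auto simp: ls_def line_list_def N_def)
  qed
  have final: "big_M G bd M lbl $ inv lbl (Ext e) $ ((h # fs) ! N)
      = M (vs ! N) (Inl e) ((Inl e' # map Inr ls) ! N)"
    using mem vertex[of N] line[of N] vsN by (simp add: big_M_nth vertex_entry_def)
  have step: "step_matrix \<beta> $ (fs ! p) $ ((h # fs) ! p)
      = exp (- \<beta> * of_real (c p)) * M (vs ! p) (Inr (ls ! p)) ((Inl e' # map Inr ls) ! p)"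
    if p: "p < N" for p
  proof -
    have int: "is_internal (lbl (fs ! p))" "label_vertex G bd (opposite (lbl (fs ! p))) = vs ! p"
      using fs p by (auto simp: label_walks_def vs_def N_def)
    have Suc_p: "vs ! Suc p = label_vertex G bd (lbl (fs ! p))"
      using p by (simp add: vs_def vertex_list_def N_def)
    have ls_p: "ls ! p = projr (label_line (lbl (fs ! p)))"
      using p by (simp add: ls_def line_list_def N_def)
    have "label_line (opposite (lbl (fs ! p))) = Inr (ls ! p)"
      using int(1) ls_p by (cases "lbl (fs ! p)") simp_all
    moreover have "penalty_factor a b \<beta> (lbl (fs ! p)) = exp (- \<beta> * of_real (c p))"
    proof (cases "lbl (fs ! p)")
      case (Ext x)
      then show ?thesis using int(1) by simp
    next
      case (Init i)
      then show ?thesis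
        using int(2) Suc_p ls_p by (simp add: c_def)
    next
      case (Term i)
      then have "i \<in> arcs G"
        using lbl_mem[of "fs ! p"] by (auto simp: basis_labels_def)
      \<comment> \<open>Absence of loops rules out the first branch of \<open>c\<close>, so arrival
        at the head is charged \<open>b\<close>.\<close>
      then have "vs ! Suc p \<noteq> tail G i"
        using Suc_p Term no_loops[of i] by simp
      then have "c p = b i"
        using ls_p Term by (simp add: c_def)
      then show ?thesis using Term by simp
    qed
    ultimately show ?thesis
      using int vertex[of p] line[of p] p by (simp add: step_matrix_nth vertex_entry_def)
  qed
  have "path_weight (big_M G bd M lbl $ inv lbl (Ext e)) (step_matrix \<beta>) h fs
      = M (vs ! N) (Inl e) ((Inl e' # map Inr ls) ! N) *
        (\<Prod>p<N. exp (- \<beta> * of_real (c p)) * M (vs ! p) (Inr (ls ! p)) ((Inl e' # map Inr ls) ! p))"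
    unfolding path_weight_def N_def[symmetric] final by (intro arg_cong2[where f = times] prod.cong refl step) simp
  also have "\<dots> = walk_weight G bd M e' ls e * exp (\<Sum>p<N. - \<beta> * of_real (c p))"
    using walk_weight_eq[OF wv] vsN len by (simp add: prod.distrib exp_sum)
  also have "(\<Sum>p<N. - \<beta> * of_real (c p)) = - \<beta> * of_real (walk_penalty G bd a b e' ls e)"
    by (simp add: walk_penalty_def wv len c_def[symmetric] sum_distrib_left)
  finally show ?thesis unfolding h_def ls_def .
qed

text \<open>An external label or a mismatch of vertices annihilates a factor of
  \<open>step_matrix\<close>; a wrong final vertex annihilates the entry of
  \<open>big_M\<close>.\<close>

lemma path_weight_eq_0:
  assumes e: "e \<in> E" and e': "e' \<in> E" and fs: "fs \<notin> label_walks e e'"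
  shows "path_weight (big_M G bd M lbl $ inv lbl (Ext e)) (step_matrix \<beta>) (inv lbl (Ext e')) fs = 0"
proof -
  define h where "h = inv lbl (Ext e')"
  have vertex: "label_vertex G bd (lbl ((h # fs) ! p)) = vertex_list e' fs ! p" if "p \<le> length fs" for p
    using label_vertex_nth[OF e'] that by (simp add: h_def)
  have mem: "Ext e \<in> basis_labels G E"
    using e by (auto simp: basis_labels_def)
  from fs consider (last) "vertex_list e' fs ! length fs \<noteq> bd e"
    | (step) p where "p < length fs" "\<not> (is_internal (lbl (fs ! p)) \<and>
        label_vertex G bd (opposite (lbl (fs ! p))) = vertex_list e' fs ! p)"
    by (auto simp: label_walks_def)
  then show ?thesis
  proof cases
    case last
    then have "big_M G bd M lbl $ inv lbl (Ext e) $ ((h # fs) ! length fs) = 0"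
      using mem vertex[of "length fs"] by (auto simp: big_M_nth vertex_entry_def)
    then show ?thesis by (simp add: path_weight_def h_def)
  next
    case step
    then have "step_matrix \<beta> $ (fs ! p) $ ((h # fs) ! p) = 0"
      using vertex[of p] by (auto simp: step_matrix_nth vertex_entry_def)
    then have "(\<Prod>p<length fs. step_matrix \<beta> $ (fs ! p) $ ((h # fs) ! p)) = 0"
      using step(1) by (intro prod_zero) auto
    then show ?thesis by (simp add: path_weight_def h_def)
  qed
qed

section \<open>Identification of the sum with \<open>T_hat\<close>\<close>

lemma
  assumes small: "\<And>h. (\<Sum>f\<in>UNIV. norm (step_matrix \<beta> $ f $ h)) \<le> 1 / 2"
  shows invertible_resolvent_arg: "invertible (resolvent_arg G bd M a b \<beta> lbl)"
    and has_sum_T_hat: "e \<in> E \<Longrightarrow> e' \<in> E \<Longrightarrow>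
      ((\<lambda>is. walk_weight G bd M e' is e * exp (- \<beta> * of_real (walk_penalty G bd a b e' is e)))
         has_sum T_hat G bd M a b \<beta> lbl e e') (walks G bd e e')"
proof -
  define Mb where "Mb = big_M G bd M lbl"
  define Z where "Z = H_mat a b \<beta> lbl ** G_mat lbl"
  have arg: "resolvent_arg G bd M a b \<beta> lbl = mat 1 - Mb ** Z"
    by (simp add: resolvent_arg_def Mb_def Z_def matrix_mul_assoc)
  have step: "step_matrix \<beta> = Z ** Mb"
    by (simp add: step_matrix_def Mb_def Z_def)
  have inv: "invertible (mat 1 - Z ** Mb)"
    using invertible_one_minus[of "step_matrix \<beta>", OF small] by (simp add: step)
  show "invertible (resolvent_arg G bd M a b \<beta> lbl)"
    unfolding arg by (rule push_through(1)[OF inv])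
  assume e: "e \<in> E" and e': "e' \<in> E"
  define R where "R = Mb $ inv lbl (Ext e)"
  define h where "h = inv lbl (Ext e')"
  \<comment> \<open>After the push-through, the row of \<open>Ext e\<close> in \<open>Mb\<close> is
    the terminal vector \<open>R\<close> of the path sums.\<close>
  have T: "T_hat G bd M a b \<beta> lbl e e' = (R v* matrix_inv (mat 1 - step_matrix \<beta>)) $ h"
    unfolding T_hat_def arg Mb_def[symmetric] push_through(2)[OF inv] step
    by (simp add: matrix_matrix_mult_def vector_matrix_mult_def R_def h_def)
  have "(path_weight R (step_matrix \<beta>) h has_sum T_hat G bd M a b \<beta> lbl e e') UNIV"
    unfolding T by (rule path_weight_has_sum[OF small])
  then have "(path_weight R (step_matrix \<beta>) h has_sum T_hat G bd M a b \<beta> lbl e e') (label_walks e e')"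
    using path_weight_eq_0[OF e e']
    by (subst has_sum_cong_neutral[where T = UNIV]) (auto simp: R_def Mb_def h_def)
  then show "((\<lambda>is. walk_weight G bd M e' is e * exp (- \<beta> * of_real (walk_penalty G bd a b e' is e)))
      has_sum T_hat G bd M a b \<beta> lbl e e') (walks G bd e e')"
    by (subst has_sum_reindex_bij_witness[where i = line_list and j = "label_list e e'" and T = "label_walks e e'"
          and h = "path_weight R (step_matrix \<beta>) h" and s' = "T_hat G bd M a b \<beta> lbl e e'"])
      (auto simp: line_list_label_list label_list_in_label_walks label_list_line_list
        line_list_in_walks path_weight_label_walk[OF e e'] R_def Mb_def h_def)
qed

end

text \<open>Invertibility is asserted alongside the sum because it makes \<open>matrix_inv\<close> a
  genuine inverse; \<open>has_sum\<close> includes convergence, and \<open>R\<close> is uniform in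
  \<open>e\<close> and \<open>e'\<close>.\<close>

theorem theorem6p7:
  fixes G :: "('v, 'i) pre_digraph" and E :: "'e set" and bd :: "'e \<Rightarrow> 'v"
    and M :: "('v, 'i, 'e) vertex_matrices"
    and a b :: "'i \<Rightarrow> real"
    and lbl :: "'k::finite \<Rightarrow> ('e, 'i) basis_label"
  assumes "noncompact_graph G E bd"
    and "\<And>i. i \<in> arcs G \<Longrightarrow> a i > 0"
    and "\<And>i. i \<in> arcs G \<Longrightarrow> b i > 0"
    and "bij_betw lbl UNIV (basis_labels G E)"
  shows "\<exists>R::real. \<forall>\<beta>::complex. Re \<beta> > R \<longrightarrow>
           invertible (resolvent_arg G bd M a b \<beta> lbl) \<and>
           (\<forall>e\<in>E. \<forall>e'\<in>E.
              ((\<lambda>is. walk_weight G bd M e' is e *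
                     exp (- \<beta> * of_real (walk_penalty G bd a b e' is e)))
                has_sum T_hat G bd M a b \<beta> lbl e e') (walks G bd e e'))"
proof -
  interpret labelled_graph G E bd M a b lbl
    by (intro labelled_graph.intro labelled_graph_axioms.intro assms)
  from step_matrix_small obtain R where
    "\<And>\<beta> h. Re \<beta> > R \<Longrightarrow> (\<Sum>f\<in>UNIV. norm (step_matrix \<beta> $ f $ h)) \<le> 1 / 2"
    by blast
  then show ?thesis
    using invertible_resolvent_arg has_sum_T_hat by (intro exI[of _ R]) blast
qed

end
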